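(* Let $\mathbb P$ be a probability measure on $\Omega_+$ under which $(\omega(x))_{x\ge0}$ is stationary and ergodic, with $\omega(0,i)=1/2$ $\mathbb P$-a.s. for all $i\ge3$, and $\mathbb P[\omega(0,1)<1,\ \omega(1,1)<1]>0$. Then $\lim_{n\to\infty}X_n/n=0$ $P_0$-a.s.
   Context: Cookie environments: $\Omega_+=([1/2,1]^{\mathbb N})^{\mathbb Z}$, $\omega(x)=(\omega(x,i))_{i\ge1}$. $P_{x,\omega}$ is the law of the nearest-neighbor process $(X_n)_{n\ge0}$ with $X_0=x$ which, on its $i$-th visit to site $z$, jumps to $z+1$ with probability $\omega(z,i)$ and to $z-1$ otherwise. Annealed measure $P_x[\cdot]=\mathbb E[P_{x,\omega}[\cdot]]$. *)

theory Defs
  imports "HOL-Probability.Probability"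
begin

type_synonym env = "int \<Rightarrow> nat \<Rightarrow> real"
  (* omega x i = probability of a right step on the i-th visit (i >= 1) to site x;
     the coordinate i = 0 is unused *)

definition env_space :: "env measure" where
  "env_space = PiM UNIV (\<lambda>_::int. PiM UNIV (\<lambda>_::nat. (borel :: real measure)))"

definition Omega_plus :: "env set" where
  "Omega_plus = {\<omega>. \<forall>x. \<forall>i\<ge>1. \<omega> x i \<in> {1/2..1}}"

definition seq_space :: "(nat \<Rightarrow> nat \<Rightarrow> real) measure" where
  "seq_space = PiM UNIV (\<lambda>_::nat. PiM UNIV (\<lambda>_::nat. (borel :: real measure)))"

definition nonneg_part :: "env \<Rightarrow> (nat \<Rightarrow> nat \<Rightarrow> real)" where
  "nonneg_part \<omega> = (\<lambda>n. \<omega> (int n))"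

definition seq_shift :: "(nat \<Rightarrow> 'a) \<Rightarrow> (nat \<Rightarrow> 'a)" where
  "seq_shift s = (\<lambda>n. s (Suc n))"

definition nonneg_law :: "env measure \<Rightarrow> (nat \<Rightarrow> nat \<Rightarrow> real) measure" where
  "nonneg_law P = distr P seq_space nonneg_part"

definition nonneg_stationary :: "env measure \<Rightarrow> bool" where
  "nonneg_stationary P \<longleftrightarrow> distr (nonneg_law P) seq_space seq_shift = nonneg_law P"

definition nonneg_ergodic :: "env measure \<Rightarrow> bool" where
  "nonneg_ergodic P \<longleftrightarrow>
     (\<forall>A \<in> sets seq_space. seq_shift -` A \<inter> space seq_space = A \<longrightarrow>
        measure (nonneg_law P) A = 0 \<or> measure (nonneg_law P) A = 1)"

(* Quenched cookie walk, driven by i.i.d. uniform[0,1] variables U 0, U 1, ...: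
   positions X_0 .. X_n as a list; from z on its i-th visit (i = number of times z
   occurs among X_0..X_n) step right iff U n < omega z i. *)
primrec cookie_path :: "env \<Rightarrow> int \<Rightarrow> (nat \<Rightarrow> real) \<Rightarrow> nat \<Rightarrow> int list" where
  "cookie_path \<omega> x U 0 = [x]"
| "cookie_path \<omega> x U (Suc n) =
     (let xs = cookie_path \<omega> x U n; z = last xs; i = count_list xs z
      in xs @ [if U n < \<omega> z i then z + 1 else z - 1])"

definition cookie_walk :: "env \<Rightarrow> int \<Rightarrow> (nat \<Rightarrow> real) \<Rightarrow> nat \<Rightarrow> int" where
  "cookie_walk \<omega> x U n = last (cookie_path \<omega> x U n)"

definition unif_seq :: "(nat \<Rightarrow> real) measure" where
  "unif_seq = PiM UNIV (\<lambda>_::nat. uniform_measure lborel {0..1::real})"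

end

theory Submission
  imports Defs
begin

text \<open>
  Fix an environment in which a positive fraction of the sites \<open>k \<ge> 0\<close> is such that the first
  cookies at \<open>k\<close> and \<open>k + 1\<close> both have strength at most \<open>1 - \<epsilon>\<close>; ergodicity makes this almost sure.
  When the walk climbs over such a pair, then with probability at least \<open>\<epsilon>\<^sup>2\<close> it steps back
  at its first visit to each of the two sites.
  Every nonnegative site below \<open>k\<close> has been visited before and so keeps at most one cookie, and
  \<open>k\<close> has none left when the walk steps back from \<open>k + 1\<close>.  Even if all remaining
  cookies push right with certainty, the excursion below \<open>k + 1\<close> reaches depth \<open>n\<close> with
  probability of order \<open>n\<^sup>-\<^sup>2\<close> and then lasts for a time of order \<open>n\<^sup>2\<close>, so its
  expected duration diverges logarithmically.

  An explicit potential, equal to a lower bound for the expected remaining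
  duration of such excursions truncated at depth \<open>2 N\<close>, turns this into a process with bounded
  increments and drift at most 1 that dominates, up to a constant, \<open>v\<^sub>N\<close> times the number of good pairs
  climbed so far, where \<open>v\<^sub>N\<close> is of order \<open>log N\<close>.  An exponential moment
  bound and Borel-Cantelli give \<open>limsup X\<^sub>n / n \<le> 3 / (c v\<^sub>N)\<close> for every \<open>N\<close>.
  The lower bound holds because all drifts are nonnegative.
\<close>

subsection \<open>Lower density of visits for an ergodic map\<close>

text \<open>Cover the orbit greedily: from a point of \<open>E\<close> jump over a block of length
  at most \<open>m\<close> on which \<open>A\<close> has frequency at most \<open>c\<close>;
  elsewhere move one step, which adds nothing. The incomplete last block costs at most
  \<open>m\<close>.\<close>

lemma birkhoff_sum_le_of_stopping:
  fixes T :: "'a \<Rightarrow> 'a"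
  assumes stop: "\<And>w. w \<in> E \<Longrightarrow> \<exists>n\<in>{1..m}. (\<Sum>k<n. indicator A ((T ^^ k) w)) \<le> c * real n"
    and "0 \<le> c"
  shows "(\<Sum>k<K. indicator (A \<inter> E) ((T ^^ k) w)) \<le> c * real K + real m"
proof (induction K arbitrary: w rule: less_induct)
  case (less K)
  show ?case
  proof (cases "K \<le> m")
    case True
    have "(\<Sum>k<K. indicator (A \<inter> E) ((T ^^ k) w)) \<le> (\<Sum>k<K. 1::real)"
      by (intro sum_mono) (auto simp: indicator_def)
    also have "\<dots> \<le> c * real K + real m"
      using True \<open>0 \<le> c\<close> by (simp add: add_increasing)
    finally show ?thesis .
  next
    case False
    have split: "(\<Sum>k<K. indicator (A \<inter> E) ((T ^^ k) w) :: real)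
        = (\<Sum>k<n. indicator (A \<inter> E) ((T ^^ k) w)) + (\<Sum>k<K - n. indicator (A \<inter> E) ((T ^^ k) ((T ^^ n) w)))"
      if "n \<le> K" for n
    proof -
      have "(\<Sum>k<K - n. indicator (A \<inter> E) ((T ^^ k) ((T ^^ n) w)))
          = (\<Sum>k<K - n. indicator (A \<inter> E) ((T ^^ (k + n)) w) :: real)"
        by (simp add: funpow_add)
      also have "\<dots> = (\<Sum>k=n..<K. indicator (A \<inter> E) ((T ^^ k) w))"
        using sum.shift_bounds_nat_ivl[of "\<lambda>k. indicator (A \<inter> E) ((T ^^ k) w) :: real" 0 n "K - n"] that
        by (simp add: atLeast0LessThan)
      finally show ?thesis
        using sum.atLeastLessThan_concat[of 0 n K "\<lambda>k. indicator (A \<inter> E) ((T ^^ k) w) :: real"] that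
        by (simp add: atLeast0LessThan)
    qed
    show ?thesis
    proof (cases "w \<in> E")
      case True
      then obtain n where n: "n \<in> {1..m}" "(\<Sum>k<n. indicator A ((T ^^ k) w)) \<le> c * real n"
        using stop by blast
      have "(\<Sum>k<n. indicator (A \<inter> E) ((T ^^ k) w) :: real) \<le> (\<Sum>k<n. indicator A ((T ^^ k) w))"
        by (intro sum_mono) (auto simp: indicator_def)
      moreover have "(\<Sum>k<K - n. indicator (A \<inter> E) ((T ^^ k) ((T ^^ n) w))) \<le> c * real (K - n) + real m"
        using n False by (intro less) auto
      ultimately show ?thesis
        using split[of n] n False by (simp add: of_nat_diff algebra_simps)
    next
      case notE: False
      have "(\<Sum>k<K - 1. indicator (A \<inter> E) ((T ^^ k) ((T ^^ 1) w))) \<le> c * real (K - 1) + real m"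
        using False by (intro less) auto
      then show ?thesis
        using split[of 1] False notE \<open>0 \<le> c\<close> by (simp add: of_nat_diff algebra_simps)
    qed
  qed
qed

text \<open>An unbounded deficit of the visits below \<open>c * n\<close> is an invariant event. If
  it had probability 1, the covering bound would contradict \<open>c < prob A\<close>.\<close>

lemma (in prob_space) ergodic_positive_density:
  assumes T [measurable]: "T \<in> measurable M M" and inv: "distr M M T = M"
    and erg: "\<And>B. B \<in> sets M \<Longrightarrow> T -` B \<inter> space M = B \<Longrightarrow> prob B = 0 \<or> prob B = 1"
    and A [measurable]: "A \<in> sets M" and pos: "prob A > 0"
  shows "AE w in M. \<exists>c>0. \<exists>K. \<forall>n. c * real n - K \<le> (\<Sum>k<n. indicator A ((T ^^ k) w))"
proof -
  define c where "c = prob A / 2"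
  define S where "S n w = (\<Sum>k<n. indicator A ((T ^^ k) w) :: real)" for n w
  have c: "0 < c" "c < prob A" using pos by (auto simp: c_def)
  have Tk [measurable]: "T ^^ k \<in> measurable M M" for k
    by (induction k) (auto simp: comp_def)
  have S_meas [measurable]: "S n \<in> borel_measurable M" for n
    unfolding S_def by measurable
  have inv_k: "distr M M (T ^^ k) = M" for k
  proof (induction k)
    case 0 then show ?case by (simp add: id_def distr_id2)
  next
    case (Suc k)
    have "distr M M (T ^^ Suc k) = distr (distr M M (T ^^ k)) M T"
      by (subst distr_distr) (auto simp: funpow.simps(2))
    then show ?case unfolding Suc inv .
  qed
  have S_shift: "S n (T w) = S (Suc n) w - indicator A w" for n w
    unfolding S_def by (subst sum.lessThan_Suc_shift) (simp add: funpow_swap1)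
  \<comment> \<open>One shift changes the deficit by a bounded amount only, so its unboundedness is
    strictly invariant, as \<open>erg\<close> requires.\<close>
  define B where "B = {w \<in> space M. \<forall>K::nat. \<exists>n. S n w + K \<le> c * real n}"
  have B_meas [measurable]: "B \<in> sets M" unfolding B_def by measurable
  have ind: "0 \<le> (indicator A w :: real)" "(indicator A w :: real) \<le> 1" for w
    by (auto simp: indicator_def)
  have "(\<forall>K::nat. \<exists>n. S n (T w) + K \<le> c * real n) \<longleftrightarrow> (\<forall>K::nat. \<exists>n. S n w + K \<le> c * real n)"
    (is "?L \<longleftrightarrow> ?R") for w
  proof
    assume L: ?L
    show ?R
    proof
      fix K :: nat
      obtain n where "S n (T w) + real (K + 1) \<le> c * real n" using L by blast
      then have "S (Suc n) w + real K \<le> c * real (Suc n)"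
        unfolding S_shift of_nat_Suc of_nat_add distrib_left using ind(2)[of w] c(1) by linarith
      then show "\<exists>n. S n w + K \<le> c * real n" by blast
    qed
  next
    assume R: ?R
    have c1: "c \<le> 1" using c prob_le_1[of A] by linarith
    show ?L
    proof
      fix K :: nat
      obtain n where n: "S n w + real (K + 1) \<le> c * real n" using R by blast
      then obtain n' where n': "n = Suc n'"
        by (cases n) (auto simp: S_def)
      have "S n' (T w) + real K \<le> c * real n'"
        using n ind(1)[of w] c1 unfolding S_shift n' of_nat_Suc of_nat_add distrib_left by linarith
      then show "\<exists>n. S n (T w) + K \<le> c * real n" by blast
    qed
  qed
  then have "T -` B \<inter> space M = B"
    using measurable_space[OF T] by (auto simp: B_def)
  then consider "prob B = 0" | "prob B = 1" using erg B_meas by blast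
  then show ?thesis
  proof cases
    case 1
    then have "AE w in M. w \<notin> B"
      by (simp add: AE_iff_measurable[OF B_meas] emeasure_eq_measure B_def)
    then show ?thesis
    proof (rule AE_mp, intro AE_I2 impI)
      fix w assume "w \<in> space M" "w \<notin> B"
      then obtain K :: nat where "\<forall>n. \<not> S n w + K \<le> c * real n" by (auto simp: B_def)
      then have "\<forall>n. c * real n - K \<le> S n w" by (meson diff_le_eq linear)
      then show "\<exists>c>0. \<exists>K. \<forall>n. c * real n - K \<le> (\<Sum>k<n. indicator A ((T ^^ k) w))"
        using c unfolding S_def by blast
    qed
  next
    case 2
    \<comment> \<open>An average of at most \<open>c\<close> occurs within the first
      \<open>m\<close> steps. The union of these sets contains \<open>B\<close>, so for large
      \<open>m\<close> less of \<open>A\<close> is lost than the gap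
      \<open>prob A - c\<close>.\<close>
    define E where "E m = {w \<in> space M. \<exists>n\<in>{1..m}. S n w \<le> c * real n}" for m
    have E_meas [measurable]: "E m \<in> sets M" for m unfolding E_def by measurable
    have "incseq E" by (fastforce simp: incseq_def E_def)
    then have lim: "(\<lambda>m. prob (E m)) \<longlonglongrightarrow> prob (\<Union>m. E m)"
      by (intro finite_Lim_measure_incseq) auto
    have "B \<subseteq> (\<Union>m. E m)"
    proof
      fix w assume w: "w \<in> B"
      then obtain n where n: "S n w + real 1 \<le> c * real n" unfolding B_def by blast
      then have "n \<noteq> 0" by (auto simp: S_def intro: ccontr)
      then have "w \<in> E n" using w n by (auto simp: E_def B_def intro!: bexI[of _ n])
      then show "w \<in> (\<Union>m. E m)" by blast
    qed
    then have "prob (\<Union>m. E m) \<ge> 1"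
      using 2 finite_measure_mono[of B "\<Union>m. E m"]
      by (simp add: sets.countable_UN)
    then have "prob (\<Union>m. E m) = 1" by (intro antisym prob_le_1)
    with lim have "(\<lambda>m. prob (E m)) \<longlonglongrightarrow> 1" by simp
    then have "\<forall>\<^sub>F m in sequentially. prob (E m) > 1 - (prob A - c)"
      using c by (intro order_tendstoD) auto
    then obtain m where m: "prob (E m) > 1 - (prob A - c)"
      by (auto simp: eventually_sequentially)
    have "prob A \<le> prob (A \<inter> E m) + prob (space M - E m)"
    proof -
      have "prob A \<le> prob ((A \<inter> E m) \<union> (space M - E m))"
        using sets.sets_into_space[OF A] by (intro finite_measure_mono) auto
      also have "\<dots> \<le> prob (A \<inter> E m) + prob (space M - E m)"
        by (intro measure_Un_le) auto
      finally show ?thesis .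
    qed
    then have big: "prob (A \<inter> E m) > c" using m by (simp add: prob_compl)
    \<comment> \<open>Integrate the covering bound; by invariance each summand integrates to
      \<open>prob (A \<inter> E m)\<close>. Large \<open>K\<close> then contradicts
      \<open>big\<close>.\<close>
    have "real K * (prob (A \<inter> E m) - c) \<le> real m" for K
    proof -
      have int: "integrable M (\<lambda>w. indicator (A \<inter> E m) ((T ^^ k) w) :: real)" for k
        by (intro integrable_const_bound[where B=1]) (auto simp: indicator_def)
      have one: "(\<integral>w. indicator (A \<inter> E m) ((T ^^ k) w) \<partial>M) = prob (A \<inter> E m)" for k
      proof -
        have "(\<integral>w. indicator (A \<inter> E m) ((T ^^ k) w) \<partial>M)
            = (\<integral>w. indicator (A \<inter> E m) w \<partial>distr M M (T ^^ k) :: real)"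
          by (subst integral_distr) auto
        then show ?thesis by (simp add: inv_k)
      qed
      have "(\<integral>w. (\<Sum>k<K. indicator (A \<inter> E m) ((T ^^ k) w)) \<partial>M) \<le> (\<integral>w. c * real K + real m \<partial>M)"
      proof (rule integral_mono)
        fix w assume "w \<in> space M"
        show "(\<Sum>k<K. indicator (A \<inter> E m) ((T ^^ k) w)) \<le> c * real K + real m"
          using c by (intro birkhoff_sum_le_of_stopping) (auto simp: E_def S_def)
      qed (use int in auto)
      then show ?thesis using int by (simp add: one prob_space algebra_simps)
    qed
    moreover obtain K where "real K > real m / (prob (A \<inter> E m) - c)"
      using reals_Archimedean2 by blast
    ultimately have False using big by (metis diff_gt_0_iff_gt linorder_not_less pos_divide_less_eq)
    then show ?thesis ..
  qed
qed

subsection \<open>Path functionals with bounded drift\<close>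

definition path_step :: "env \<Rightarrow> int list \<Rightarrow> real \<Rightarrow> int list" where
  "path_step \<omega> xs u =
     xs @ [if u < \<omega> (last xs) (count_list xs (last xs)) then last xs + 1 else last xs - 1]"

text \<open>Starting from an arbitrary history allows the first step to be split off, so that
  inductions can run over all histories.\<close>

primrec path_from :: "env \<Rightarrow> int list \<Rightarrow> (nat \<Rightarrow> real) \<Rightarrow> nat \<Rightarrow> int list" where
  "path_from \<omega> xs U 0 = xs"
| "path_from \<omega> xs U (Suc n) = path_step \<omega> (path_from \<omega> xs U n) (U n)"

lemma cookie_path_eq: "cookie_path \<omega> x U n = path_from \<omega> [x] U n"
  by (induction n) (simp_all add: path_step_def Let_def)

lemma path_from_Suc_shift:
  "path_from \<omega> xs U (Suc n) = path_from \<omega> (path_step \<omega> xs (U 0)) (\<lambda>k. U (Suc k)) n"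
  by (induction n) simp_all

abbreviation unif01 :: "real measure" where
  "unif01 \<equiv> uniform_measure lborel {0..1}"

interpretation unif: prob_space unif01
  by (rule prob_space_uniform_measure) simp_all

interpretation unif_seq: sequence_space unif01
  by standard

lemma path_from_measurable [measurable]:
  "(\<lambda>U. path_from \<omega> xs U n) \<in> measurable unif_seq (count_space UNIV)"
proof (induction n)
  case 0 then show ?case by simp
next
  case (Suc n)
  have "(\<lambda>U. path_step \<omega> ys (U n)) \<in> measurable unif_seq (count_space UNIV)" for ys
    unfolding path_step_def unif_seq_def by measurable
  from measurable_compose_countable[OF this Suc] show ?case by simp
qed

lemma nn_integral_unif_seq_Cons:
  assumes "f \<in> borel_measurable unif_seq"
  shows "(\<integral>\<^sup>+U. f U \<partial>unif_seq) = (\<integral>\<^sup>+u. \<integral>\<^sup>+U. f (case_nat u U) \<partial>unif_seq \<partial>unif01)"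
proof -
  note [measurable] = assms[unfolded unif_seq_def]
  interpret S: prob_space unif_seq unfolding unif_seq_def by unfold_locales
  have "(\<integral>\<^sup>+U. f U \<partial>unif_seq)
      = (\<integral>\<^sup>+p. f (case_nat (fst p) (snd p)) \<partial>(unif01 \<Otimes>\<^sub>M unif_seq))"
    unfolding unif_seq_def
    by (subst unif_seq.PiM_iter[symmetric], subst nn_integral_distr) (auto simp: split_beta')
  also have "\<dots> = (\<integral>\<^sup>+u. \<integral>\<^sup>+U. f (case_nat u U) \<partial>unif_seq \<partial>unif01)"
    by (subst S.nn_integral_fst[symmetric]) (simp_all add: unif_seq_def)
  finally show ?thesis .
qed

lemma nn_integral_unif01_if:
  assumes "0 \<le> p" "p \<le> 1" "0 \<le> a" "0 \<le> b"
  shows "(\<integral>\<^sup>+u. ennreal (if u < p then a else b) \<partial>unif01) = ennreal (p * a + (1 - p) * b)"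
proof -
  have "(\<integral>\<^sup>+u. ennreal (if u < p then a else b) \<partial>unif01)
      = (\<integral>\<^sup>+u. ennreal a * indicator {0..<p} u + ennreal b * indicator {p..1} u \<partial>lborel)"
    using assms(1,2) by (subst nn_integral_uniform_measure)
      (auto simp: divide_ennreal_def intro!: nn_integral_cong split: split_indicator)
  also have "\<dots> = ennreal (p * a + (1 - p) * b)"
    using assms by (subst nn_integral_add) (auto simp: nn_integral_cmult ennreal_mult' ennreal_plus mult.commute)
  finally show ?thesis .
qed

text \<open>Condition on the first step: the rest of the path is driven by the shifted uniforms from
  the extended history, so the induction hypothesis applies and \<open>drift\<close> contributes one
  more factor \<open>exp \<kappa>\<close>.\<close>

lemma exp_moment_path_from:
  assumes omega: "\<And>x i. i \<ge> 1 \<Longrightarrow> 0 \<le> \<omega> x i \<and> \<omega> x i \<le> 1"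
    and step: "\<And>xs. I xs \<Longrightarrow> xs \<noteq> [] \<and> I (xs @ [last xs + 1]) \<and> I (xs @ [last xs - 1])"
    and drift: "\<And>xs p. I xs \<Longrightarrow> p = \<omega> (last xs) (count_list xs (last xs)) \<Longrightarrow>
        p * exp (h (xs @ [last xs + 1])) + (1 - p) * exp (h (xs @ [last xs - 1])) \<le> exp (h xs + \<kappa>)"
    and "I xs"
  shows "(\<integral>\<^sup>+U. ennreal (exp (h (path_from \<omega> xs U n))) \<partial>unif_seq) \<le> ennreal (exp (h xs + n * \<kappa>))"
  using \<open>I xs\<close>
proof (induction n arbitrary: xs)
  case 0
  interpret S: prob_space unif_seq unfolding unif_seq_def by unfold_locales
  show ?case by (simp add: S.emeasure_space_1)
next
  case (Suc n)
  let ?z = "last xs" and ?p = "\<omega> (last xs) (count_list xs (last xs))"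
  have "count_list xs ?z \<ge> 1"
    using step[OF Suc.prems] by (metis One_nat_def Suc_leI count_list_0_iff gr0I last_in_set)
  then have p: "0 \<le> ?p" "?p \<le> 1" using omega by auto
  have "(\<integral>\<^sup>+U. ennreal (exp (h (path_from \<omega> xs U (Suc n)))) \<partial>unif_seq)
     = (\<integral>\<^sup>+u. \<integral>\<^sup>+U. ennreal (exp (h (path_from \<omega> (path_step \<omega> xs u) U n))) \<partial>unif_seq \<partial>unif01)"
  proof (subst nn_integral_unif_seq_Cons)
    show "(\<lambda>U. ennreal (exp (h (path_from \<omega> xs U (Suc n))))) \<in> borel_measurable unif_seq"
      by measurable
  qed (simp del: path_from.simps add: path_from_Suc_shift)
  also have "\<dots> \<le> (\<integral>\<^sup>+u. ennreal (exp (h (path_step \<omega> xs u) + n * \<kappa>)) \<partial>unif01)"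
    using step[OF Suc.prems] by (intro nn_integral_mono Suc.IH) (auto simp: path_step_def)
  also have "\<dots> = (\<integral>\<^sup>+u. ennreal (if u < ?p then exp (h (xs @ [?z + 1]) + n * \<kappa>)
      else exp (h (xs @ [?z - 1]) + n * \<kappa>)) \<partial>unif01)"
    by (intro nn_integral_cong) (simp add: path_step_def)
  also have "\<dots> = ennreal (?p * exp (h (xs @ [?z + 1]) + n * \<kappa>) + (1 - ?p) * exp (h (xs @ [?z - 1]) + n * \<kappa>))"
    using p by (intro nn_integral_unif01_if) auto
  also have "\<dots> = ennreal ((?p * exp (h (xs @ [?z + 1])) + (1 - ?p) * exp (h (xs @ [?z - 1]))) * exp (n * \<kappa>))"
    by (simp add: exp_add algebra_simps)
  also have "\<dots> \<le> ennreal (exp (h xs + \<kappa>) * exp (n * \<kappa>))"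
    using drift[OF Suc.prems refl] by (intro ennreal_leI mult_right_mono) auto
  also have "\<dots> = ennreal (exp (h xs + Suc n * \<kappa>))"
    by (simp add: exp_add[symmetric] algebra_simps)
  finally show ?case .
qed

text \<open>Multiply by \<open>1 - x > 0\<close> and use
  \<open>1 - x \<le> exp (- x)\<close>.\<close>

lemma exp_le_quadratic:
  fixes x :: real
  assumes "\<bar>x\<bar> \<le> 1/2"
  shows "exp x \<le> 1 + x + 2 * x\<^sup>2"
proof -
  have "exp x * (1 - x) \<le> exp x * exp (- x)"
    using exp_ge_add_one_self[of "- x"] by (intro mult_left_mono) auto
  also have "\<dots> = 1" by (simp add: exp_minus)
  also have "1 \<le> (1 + x + 2 * x\<^sup>2) * (1 - x)"
  proof -
    have "(1 + x + 2 * x\<^sup>2) * (1 - x) = 1 + x\<^sup>2 * (1 - 2 * x)"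
      by (simp add: algebra_simps power2_eq_square)
    moreover have "0 \<le> x\<^sup>2 * (1 - 2 * x)" using assms by (intro mult_nonneg_nonneg) auto
    ultimately show ?thesis by simp
  qed
  finally show ?thesis using assms by (auto dest!: mult_right_le_imp_le)
qed

lemma exp_drift:
  assumes p: "0 \<le> p" "p \<le> (1::real)" and C: "\<bar>a\<bar> \<le> C" "\<bar>b\<bar> \<le> C" and drift: "p * a + (1 - p) * b \<le> \<delta>"
    and \<theta>: "0 \<le> \<theta>" "\<theta> * C \<le> 1/2"
  shows "p * exp (\<theta> * a) + (1 - p) * exp (\<theta> * b) \<le> exp (\<theta> * \<delta> + 2 * \<theta>\<^sup>2 * C\<^sup>2)"
proof -
  have le: "exp (\<theta> * y) \<le> 1 + \<theta> * y + 2 * \<theta>\<^sup>2 * C\<^sup>2" if "\<bar>y\<bar> \<le> C" for y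
  proof -
    have "\<bar>\<theta> * y\<bar> \<le> \<theta> * C" using that \<theta>(1) by (simp add: abs_mult mult_left_mono)
    then have "exp (\<theta> * y) \<le> 1 + \<theta> * y + 2 * (\<theta> * y)\<^sup>2"
      using \<theta>(2) by (intro exp_le_quadratic) linarith
    moreover have "y\<^sup>2 \<le> C\<^sup>2" using that by (intro abs_le_square_iff[THEN iffD1]) auto
    ultimately show ?thesis
      using mult_left_mono[of "y\<^sup>2" "C\<^sup>2" "2 * \<theta>\<^sup>2"] by (simp add: power_mult_distrib algebra_simps)
  qed
  have "p * exp (\<theta> * a) + (1 - p) * exp (\<theta> * b)
     \<le> p * (1 + \<theta> * a + 2 * \<theta>\<^sup>2 * C\<^sup>2) + (1 - p) * (1 + \<theta> * b + 2 * \<theta>\<^sup>2 * C\<^sup>2)"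
    using p le[OF C(1)] le[OF C(2)] by (intro add_mono mult_left_mono) auto
  also have "\<dots> = 1 + (\<theta> * (p * a + (1 - p) * b) + 2 * \<theta>\<^sup>2 * C\<^sup>2)"
    by (simp add: algebra_simps)
  also have "\<dots> \<le> 1 + (\<theta> * \<delta> + 2 * \<theta>\<^sup>2 * C\<^sup>2)"
    using drift \<theta>(1) by (intro add_left_mono add_right_mono mult_left_mono) auto
  also have "\<dots> \<le> exp (\<theta> * \<delta> + 2 * \<theta>\<^sup>2 * C\<^sup>2)" by (rule exp_ge_add_one_self)
  finally show ?thesis .
qed

text \<open>Chernoff's bound makes exceeding \<open>(\<delta> + \<eta>) * n\<close> exponentially
  unlikely in \<open>n\<close>, and Borel-Cantelli applies.\<close>

lemma AE_path_functional_le: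
  fixes Z :: "int list \<Rightarrow> real"
  assumes omega: "\<And>x i. i \<ge> 1 \<Longrightarrow> 0 \<le> \<omega> x i \<and> \<omega> x i \<le> 1"
    and step: "\<And>xs. I xs \<Longrightarrow> xs \<noteq> [] \<and> I (xs @ [last xs + 1]) \<and> I (xs @ [last xs - 1])"
    and bound: "\<And>xs. I xs \<Longrightarrow> \<bar>Z (xs @ [last xs + 1]) - Z xs\<bar> \<le> C \<and> \<bar>Z (xs @ [last xs - 1]) - Z xs\<bar> \<le> C"
    and drift: "\<And>xs p. I xs \<Longrightarrow> p = \<omega> (last xs) (count_list xs (last xs)) \<Longrightarrow>
        p * (Z (xs @ [last xs + 1]) - Z xs) + (1 - p) * (Z (xs @ [last xs - 1]) - Z xs) \<le> \<delta>"
    and I0: "I xs\<^sub>0" and \<eta>: "\<eta> > 0"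
  shows "AE U in unif_seq. \<forall>\<^sub>F n in sequentially. Z (path_from \<omega> xs\<^sub>0 U n) \<le> (\<delta> + \<eta>) * n"
proof -
  interpret S: prob_space unif_seq unfolding unif_seq_def by unfold_locales
  have C0: "0 \<le> C" using bound[OF I0] by linarith
  \<comment> \<open>The first term keeps exponents within the range of the quadratic bound; the
    second keeps the quadratic error below half of the slack \<open>\<theta> * \<eta>\<close>. Using
    \<open>C + 1\<close> avoids division by zero.\<close>
  define \<theta> where "\<theta> = min (1 / (2 * (C + 1))) (\<eta> / (4 * (C + 1)\<^sup>2))"
  have \<theta>: "0 < \<theta>" "\<theta> * (C + 1) \<le> 1/2" "\<theta> * (C + 1)\<^sup>2 \<le> \<eta> / 4"
  proof -
    show "0 < \<theta>" using C0 \<eta> by (auto simp: \<theta>_def)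
    have "\<theta> * (C + 1) \<le> 1 / (2 * (C + 1)) * (C + 1)"
      using C0 by (intro mult_right_mono) (auto simp: \<theta>_def)
    also have "\<dots> = 1/2" using C0 by (simp add: field_simps)
    finally show "\<theta> * (C + 1) \<le> 1/2" .
    have "\<theta> * (C + 1)\<^sup>2 \<le> \<eta> / (4 * (C + 1)\<^sup>2) * (C + 1)\<^sup>2"
      using C0 by (intro mult_right_mono) (auto simp: \<theta>_def)
    also have "\<dots> = \<eta> / 4" using C0 by simp
    finally show "\<theta> * (C + 1)\<^sup>2 \<le> \<eta> / 4" .
  qed
  define \<kappa> where "\<kappa> = \<theta> * \<delta> + 2 * \<theta>\<^sup>2 * (C + 1)\<^sup>2"
  have \<kappa>: "\<kappa> - \<theta> * (\<delta> + \<eta>) \<le> - (\<theta> * \<eta> / 2)"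
    using mult_left_mono[OF \<theta>(3), of "2 * \<theta>"] \<theta>(1) by (simp add: \<kappa>_def algebra_simps power2_eq_square)
  have moment: "(\<integral>\<^sup>+U. ennreal (exp (\<theta> * Z (path_from \<omega> xs\<^sub>0 U n))) \<partial>unif_seq)
      \<le> ennreal (exp (\<theta> * Z xs\<^sub>0 + n * \<kappa>))" for n
  proof (rule exp_moment_path_from[where I = I and h = "\<lambda>xs. \<theta> * Z xs"])
    fix xs p assume xs: "I xs" and p: "p = \<omega> (last xs) (count_list xs (last xs))"
    have "count_list xs (last xs) \<ge> 1"
      using step[OF xs] by (metis One_nat_def Suc_leI count_list_0_iff gr0I last_in_set)
    then have p01: "0 \<le> p" "p \<le> 1" using omega p by auto
    let ?a = "Z (xs @ [last xs + 1]) - Z xs" and ?b = "Z (xs @ [last xs - 1]) - Z xs"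
    have "p * exp (\<theta> * ?a) + (1 - p) * exp (\<theta> * ?b) \<le> exp \<kappa>"
      unfolding \<kappa>_def using p01 bound[OF xs] drift[OF xs p] \<theta> by (intro exp_drift) auto
    then have "(p * exp (\<theta> * ?a) + (1 - p) * exp (\<theta> * ?b)) * exp (\<theta> * Z xs) \<le> exp \<kappa> * exp (\<theta> * Z xs)"
      by (intro mult_right_mono) auto
    also have "(p * exp (\<theta> * ?a) + (1 - p) * exp (\<theta> * ?b)) * exp (\<theta> * Z xs)
        = p * (exp (\<theta> * ?a) * exp (\<theta> * Z xs)) + (1 - p) * (exp (\<theta> * ?b) * exp (\<theta> * Z xs))"
      by (simp add: algebra_simps)
    finally show "p * exp (\<theta> * Z (xs @ [last xs + 1])) + (1 - p) * exp (\<theta> * Z (xs @ [last xs - 1]))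
        \<le> exp (\<theta> * Z xs + \<kappa>)"
      by (simp add: exp_add[symmetric] algebra_simps)
  qed (use omega step I0 in auto)
  define A where "A n = {U \<in> space unif_seq. Z (path_from \<omega> xs\<^sub>0 U n) > (\<delta> + \<eta>) * n}" for n
  have A_meas [measurable]: "A n \<in> sets unif_seq" for n unfolding A_def by measurable
  have A_le: "S.prob (A n) \<le> exp (\<theta> * Z xs\<^sub>0) * exp (- (\<theta> * \<eta> / 2)) ^ n" for n
  proof -
    have "emeasure unif_seq (A n) = (\<integral>\<^sup>+U. indicator (A n) U \<partial>unif_seq)" by simp
    also have "\<dots> \<le> (\<integral>\<^sup>+U. ennreal (exp (- (\<theta> * ((\<delta> + \<eta>) * n)))) * ennreal (exp (\<theta> * Z (path_from \<omega> xs\<^sub>0 U n))) \<partial>unif_seq)"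
      using \<theta>(1) by (intro nn_integral_mono)
        (auto simp: A_def ennreal_mult'[symmetric] exp_add[symmetric] split: split_indicator)
    also have "\<dots> \<le> ennreal (exp (- (\<theta> * ((\<delta> + \<eta>) * n)))) * ennreal (exp (\<theta> * Z xs\<^sub>0 + n * \<kappa>))"
      by (subst nn_integral_cmult) (auto intro!: mult_left_mono moment)
    also have "\<dots> = ennreal (exp (\<theta> * Z xs\<^sub>0 + n * (\<kappa> - \<theta> * (\<delta> + \<eta>))))"
      by (simp add: ennreal_mult'[symmetric] exp_add[symmetric] algebra_simps)
    also have "\<dots> \<le> ennreal (exp (\<theta> * Z xs\<^sub>0 + n * (- (\<theta> * \<eta> / 2))))"
      using \<kappa> by (intro ennreal_leI iffD2[OF exp_le_cancel_iff] add_left_mono mult_left_mono) auto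
    also have "exp (\<theta> * Z xs\<^sub>0 + n * (- (\<theta> * \<eta> / 2))) = exp (\<theta> * Z xs\<^sub>0) * exp (- (\<theta> * \<eta> / 2)) ^ n"
      by (simp only: exp_add exp_of_nat_mult)
    finally show ?thesis by (simp add: S.emeasure_eq_measure)
  qed
  have "summable (\<lambda>n. exp (\<theta> * Z xs\<^sub>0) * exp (- (\<theta> * \<eta> / 2)) ^ n)"
    using \<theta>(1) \<eta> by (intro summable_mult summable_geometric) auto
  then have "summable (\<lambda>n. S.prob (A n))"
    by (rule summable_comparison_test'[where N = 0]) (use A_le in auto)
  then have "AE U in unif_seq. \<forall>\<^sub>F n in sequentially. U \<in> space unif_seq - A n"
    by (intro borel_cantelli_AE1) (auto simp: S.emeasure_eq_measure)
  then show ?thesis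
    by (auto simp: A_def not_less elim!: AE_mp eventually_mono)
qed

subsection \<open>The potential of an excursion\<close>

text \<open>
  With \<open>\<alpha>\<^sub>d\<close> the coefficient below, \<open>\<alpha>\<^sub>d t - t\<^sup>2\<close> is the potential at distance \<open>t\<close> below the
  maximum when the sites at distance at most \<open>d\<close> have no cookies left.  The term \<open>- t\<^sup>2\<close>
  gives drift exactly 1 for simple random walk, and \<open>\<alpha>\<^sub>d (d + 1) = \<alpha>\<^sub>d\<^sub>+\<^sub>1 d + 2 d + 2\<close> is the
  same balance at a new site whose cookie pushes right with certainty.  Keeping \<open>\<alpha>\<^sub>d = 2 N\<close> for
  \<open>d \<ge> N\<close> makes the potential vanish at depth \<open>2 N\<close>, where the excursion is truncated.
\<close>

definition depth_coeff :: "nat \<Rightarrow> nat \<Rightarrow> real" where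
  "depth_coeff N n = (if N \<le> n then 2 * N else n * (2 + 2 * (\<Sum>j=n..<N. 1 / real j)))"

text \<open>Divided by \<open>n * (n + 1)\<close> the recursion telescopes:
  \<open>depth_coeff N n / n\<close> drops by \<open>2 / n\<close> at each step until it equals 2 at
  \<open>n = N\<close>, whence the harmonic sum.\<close>

lemma depth_coeff_step:
  assumes "1 \<le> n" "n < N"
  shows "depth_coeff N n * (n + 1) = depth_coeff N (Suc n) * n + 2 * n + 2"
proof -
  define H where "H = (\<Sum>j=Suc n..<N. 1 / real j)"
  have "(\<Sum>j=n..<N. 1 / real j) = 1 / n + H"
    using assms by (simp add: H_def sum.atLeast_Suc_lessThan)
  moreover have "depth_coeff N (Suc n) = (n + 1) * (2 + 2 * H)"
    using assms by (auto simp: depth_coeff_def H_def)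
  ultimately show ?thesis
    using assms by (simp add: depth_coeff_def field_simps)
qed

lemma depth_coeff_step_le:
  assumes "1 \<le> n"
  shows "depth_coeff N n * (n + 1) \<le> depth_coeff N (Suc n) * n + 2 * n + 2"
  using depth_coeff_step[OF assms, of N] by (cases "n < N") (auto simp: depth_coeff_def algebra_simps)

lemma depth_coeff_ge:
  assumes "n \<le> N"
  shows "2 * n \<le> depth_coeff N n"
proof -
  have "0 \<le> (\<Sum>j=n..<N. 1 / real j)" by (intro sum_nonneg) auto
  then show ?thesis using assms by (auto simp: depth_coeff_def algebra_simps)
qed

lemma depth_coeff_mono:
  assumes "1 \<le> n"
  shows "depth_coeff N n \<le> depth_coeff N (Suc n)"
proof (cases "n < N")
  case True
  have "2 * (n + 1) \<le> depth_coeff N (Suc n)" using depth_coeff_ge[of "Suc n" N] True by simp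
  then have "depth_coeff N n * (n + 1) \<le> depth_coeff N (Suc n) * (n + 1)"
    using depth_coeff_step[OF assms True] by (simp add: algebra_simps)
  then show ?thesis by (rule mult_right_le_imp_le) simp
next
  case False
  then show ?thesis by (simp add: depth_coeff_def)
qed

lemma depth_coeff_le:
  assumes "1 \<le> n"
  shows "depth_coeff N n \<le> 2 * N"
proof -
  have "depth_coeff N n \<le> depth_coeff N (n + k)" for k
  proof (induction k)
    case (Suc k)
    then show ?case using depth_coeff_mono[of "n + k" N] assms by simp
  qed simp
  from this[of N] show ?thesis by (simp add: depth_coeff_def)
qed

lemma depth_coeff_nonneg: "0 \<le> depth_coeff N n"
  by (auto simp: depth_coeff_def intro!: mult_nonneg_nonneg add_nonneg_nonneg sum_nonneg)

definition excursion_pot :: "nat \<Rightarrow> nat \<Rightarrow> nat \<Rightarrow> real" where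
  "excursion_pot N t d = (if 2 * N \<le> d then 0 else depth_coeff N d * t - (real t)\<^sup>2)"

lemma excursion_pot_0 [simp]: "excursion_pot N 0 d = 0"
  by (simp add: excursion_pot_def)

lemma excursion_pot_interior:
  assumes "1 \<le> t"
  shows "excursion_pot N t d - 1/2 * excursion_pot N (t - 1) d - 1/2 * excursion_pot N (t + 1) d \<le> 1"
  using assms by (simp add: excursion_pot_def of_nat_diff power2_eq_square field_simps)

text \<open>The walk stands one below the deepest level left so far, where a cookie of any strength
  \<open>p\<close> may remain. For \<open>d + 1 < 2 * N\<close> the bound is affine in
  \<open>p\<close>: at \<open>p = 1/2\<close> it follows from monotonicity of the coefficients, at
  \<open>p = 1\<close> from their recursion.\<close>

lemma excursion_pot_fresh:
  assumes d: "1 \<le> d" and p: "1/2 \<le> p" "p \<le> 1"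
  shows "excursion_pot N (d + 1) d - p * excursion_pot N d (d + 1)
      - (1 - p) * excursion_pot N (d + 2) (d + 1) \<le> 1"
proof -
  consider "2 * N \<le> d" | "2 * N = d + 1" | "d + 1 < 2 * N" by linarith
  then show ?thesis
  proof cases
    case 2
    \<comment> \<open>The next state is truncated. The current potential vanishes too, since
      \<open>d \<ge> N\<close> makes the coefficient \<open>2 * N = d + 1\<close>.\<close>
    then have "depth_coeff N d = real d + 1"
      using d by (simp add: depth_coeff_def flip: of_nat_Suc)
    then show ?thesis using 2 by (simp add: excursion_pot_def power2_eq_square algebra_simps)
  next
    case 3
    define a b where "a = depth_coeff N d" and "b = depth_coeff N (Suc d)"
    define L R1 R2 where "L = a * (d + 1) - (real d + 1)\<^sup>2"
      and "R1 = b * d - (real d)\<^sup>2" and "R2 = b * (d + 2) - (real d + 2)\<^sup>2"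
    have "a * (d + 1) \<le> b * (d + 1)"
      using depth_coeff_mono[OF d] by (intro mult_right_mono) (auto simp: a_def b_def)
    then have 1: "L \<le> 1 + (R1 + R2) / 2"
      by (simp add: L_def R1_def R2_def power2_eq_square field_simps)
    have 2: "L \<le> 1 + R1"
      using depth_coeff_step_le[OF d, of N]
      by (simp add: L_def R1_def a_def b_def power2_eq_square algebra_simps)
    have "(2 - 2 * p) * L + (2 * p - 1) * L \<le> (2 - 2 * p) * (1 + (R1 + R2) / 2) + (2 * p - 1) * (1 + R1)"
      using 1 2 p by (intro add_mono mult_left_mono) auto
    then have "L \<le> 1 + p * R1 + (1 - p) * R2" by (simp add: field_simps)
    then show ?thesis using 3
      by (simp add: excursion_pot_def L_def R1_def R2_def a_def b_def add.commute)
  qed (simp add: excursion_pot_def)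
qed

lemma excursion_pot_bound:
  assumes "t \<le> d + 1" "1 \<le> d"
  shows "\<bar>excursion_pot N t d\<bar> \<le> 8 * (real N)\<^sup>2"
proof (cases "2 * N \<le> d")
  case False
  then have t: "real t \<le> 2 * N" using assms by simp
  have "depth_coeff N d * t \<le> real (2 * N) * real (2 * N)"
    using t assms by (intro mult_mono depth_coeff_le depth_coeff_nonneg) auto
  moreover have "0 \<le> depth_coeff N d * t" by (simp add: depth_coeff_nonneg)
  moreover have "(real t)\<^sup>2 \<le> (real (2 * N))\<^sup>2" using t by (intro power_mono) auto
  ultimately have "\<bar>depth_coeff N d * t - (real t)\<^sup>2\<bar> \<le> 8 * (real N)\<^sup>2"
    by (simp add: abs_le_iff power2_eq_square)
      (smt (verit) mult_nonneg_nonneg of_nat_0_le_iff)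
  then show ?thesis using False by (simp add: excursion_pot_def)
qed (simp add: excursion_pot_def)

text \<open>
  A state \<open>(x, m, d, f, s)\<close> consists of the position, the maximum so far, the depth below \<open>m\<close>
  reached before the present time since the first visit to \<open>m\<close> (but at least 1), a flag for an excursion
  below \<open>m\<close> that counts (\<open>m - 1\<close> had been visited twice when \<open>m\<close> was reached, and the walk
  has not left \<open>m\<close> a second time), and a flag for being at the first visit to \<open>m\<close>.
\<close>

type_synonym climb_state = "int \<times> int \<times> nat \<times> bool \<times> bool"

text \<open>The depth is updated with the old position \<open>x\<close>, so a newly reached level
  enters \<open>d\<close> only when it is left. At a new maximum, \<open>\<not> s\<close> says that
  the old maximum is being left after at least its second visit.\<close>

fun climb_upd :: "climb_state \<Rightarrow> int \<Rightarrow> climb_state" where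
  "climb_upd (x, m, d, f, s) y =
     (if y > m then (y, y, 1, \<not> s, True)
      else (y, m, max d (nat (m - x)), f \<and> (s \<or> x < m), False))"

text \<open>\<open>tl\<close> is taken because the initial state already accounts for the start at
  0.\<close>

definition climb_state :: "int list \<Rightarrow> climb_state" where
  "climb_state xs = foldl climb_upd (0, 0, 1, False, True) (tl xs)"

lemma climb_state_snoc [simp]:
  "xs \<noteq> [] \<Longrightarrow> climb_state (xs @ [y]) = climb_upd (climb_state xs) y"
  by (simp add: climb_state_def)

text \<open>\<open>butlast\<close> lists the visits before the present one: two visits there make
  the present visit at least the third, which has no drift at a nonnegative site.\<close>

fun climb_ok :: "int list \<Rightarrow> climb_state \<Rightarrow> bool" where
  "climb_ok xs (x, m, d, f, s) \<longleftrightarrow>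
     xs \<noteq> [] \<and> x = last xs \<and> x \<le> m \<and> 0 \<le> m \<and> m - x \<le> int d + 1 \<and> 1 \<le> d \<and>
     (\<forall>z\<in>set xs. z \<le> m) \<and>
     (s \<longrightarrow> d = 1 \<and> x = m \<and> m \<notin> set (butlast xs)) \<and>
     (\<not> s \<longrightarrow> m \<in> set (butlast xs)) \<and>
     (\<forall>z. 0 \<le> z \<longrightarrow> z < m \<longrightarrow> z \<in> set (butlast xs)) \<and>
     (f \<longrightarrow> (\<forall>z. 0 \<le> z \<longrightarrow> m - int d \<le> z \<longrightarrow> z < m \<longrightarrow> 2 \<le> count_list (butlast xs) z))"

lemma count_list_eq_butlast:
  "xs \<noteq> [] \<Longrightarrow> count_list xs z = count_list (butlast xs) z + (if z = last xs then 1 else 0)"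
  by (induction xs rule: rev_induct) auto

lemma set_eq_butlast: "xs \<noteq> [] \<Longrightarrow> set xs = insert (last xs) (set (butlast xs))"
  by (induction xs rule: rev_induct) auto

lemma count_list_pos: "z \<in> set xs \<Longrightarrow> 1 \<le> count_list xs z"
  by (metis One_nat_def Suc_leI count_list_0_iff gr0I)

lemma climb_ok_upd:
  assumes ok: "climb_ok xs (x, m, d, f, s)" and y: "y = x + 1 \<or> y = x - 1"
  shows "climb_ok (xs @ [y]) (climb_upd (x, m, d, f, s) y)"
proof (cases "y > m")
  case True
  then have xm: "x = m" "y = m + 1" using ok y by auto
  have "2 \<le> count_list xs m" if "\<not> s"
    using that ok xm count_list_eq_butlast[of xs m] count_list_pos[of m "butlast xs"] by auto
  moreover have "z \<in> set xs" if "0 \<le> z" "z < m + 1" for z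
    using that ok xm set_eq_butlast[of xs] by (cases "z = m") auto
  ultimately show ?thesis
    using ok xm by (auto dest!: spec)
next
  case False
  have count: "2 \<le> count_list xs z"
    if z: "0 \<le> z" "m - int (max d (nat (m - x))) \<le> z" "z < m" and f: "f" for z
  proof (cases "m - int d \<le> z")
    case True
    then show ?thesis using ok z f count_list_eq_butlast[of xs z] by fastforce
  next
    case F: False
    \<comment> \<open>The only site newly covered is the present one: visited once on the way up to
      \<open>m\<close>, and now again.\<close>
    then have "z = x" using ok z by auto
    moreover have "z \<in> set (butlast xs)" using ok z by auto
    ultimately show ?thesis
      using ok count_list_eq_butlast[of xs z] count_list_pos[of z "butlast xs"] by auto
  qed
  have "m \<in> set xs" using ok set_eq_butlast[of xs] by (cases s) auto
  moreover have "z \<in> set xs" if "0 \<le> z" "z < m" for z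
    using that ok set_eq_butlast[of xs] by auto
  ultimately show ?thesis
    using ok y False count by auto
qed

section \<open>Drift of the climbing potential in a fixed environment\<close>

locale climb =
  fixes \<omega> :: env and N :: nat and \<epsilon> :: real and good :: "int \<Rightarrow> bool"
  assumes N: "1 \<le> N" and eps: "0 < \<epsilon>" "\<epsilon> \<le> 1"
    and omega: "\<And>x i. 1 \<le> i \<Longrightarrow> 1/2 \<le> \<omega> x i \<and> \<omega> x i \<le> 1"
    and half: "\<And>x i. 0 \<le> x \<Longrightarrow> 3 \<le> i \<Longrightarrow> \<omega> x i = 1/2"
    and good: "\<And>k. good k \<Longrightarrow> 2 * int N \<le> k \<and> \<omega> k 1 \<le> 1 - \<epsilon>"
begin

text \<open>At the first visit to a good \<open>m\<close> the walk steps back with probability at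
  least \<open>\<epsilon>\<close>, and the excursion then starts with potential
  \<open>excursion_pot N 1 1 = depth_coeff N 1 - 1\<close>.\<close>

definition "reward = \<epsilon> * (depth_coeff N 1 - 1)"

lemma reward_nonneg: "0 \<le> reward"
  using depth_coeff_ge[of 1 N] N eps by (auto simp: reward_def)

text \<open>
  \<open>level_pot\<close> accounts for the current excursion below \<open>m\<close>, \<open>next_pot\<close> for the chance that the
  excursion below \<open>m + 1\<close> will count, which requires a step back from the first visit to \<open>m\<close>.
  Each good pair contributes \<open>\<epsilon> * reward\<close>, exactly the value of \<open>next_pot\<close> when its lower site is first
  reached, so reaching a new maximum costs nothing.
\<close>

fun level_pot :: "climb_state \<Rightarrow> real" where
  "level_pot (x, m, d, f, s) =
     (if \<not> f \<or> \<not> good m then 0 else if s then reward else excursion_pot N (nat (m - x)) d)"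

fun next_pot :: "climb_state \<Rightarrow> real" where
  "next_pot (x, m, d, f, s) =
     (if \<not> good (m + 1) then 0 else if s then (if good m then \<epsilon> * reward else 0) else reward)"

definition good_pairs :: "int \<Rightarrow> real" where
  "good_pairs m = (\<Sum>k\<in>{0..m}. if good k \<and> good (k + 1) then 1 else 0)"

fun climb_pot :: "climb_state \<Rightarrow> real" where
  "climb_pot (x, m, d, f, s) =
     \<epsilon> * reward * good_pairs m - level_pot (x, m, d, f, s) - next_pot (x, m, d, f, s)"

lemma good_pairs_Suc:
  "0 \<le> m \<Longrightarrow> good_pairs (m + 1) = good_pairs m + (if good (m + 1) \<and> good (m + 2) then 1 else 0)"
proof -
  assume "0 \<le> m"
  then have "{0..m + 1} = insert (m + 1) {0..m}" by auto
  then show ?thesis by (simp add: good_pairs_def add.commute)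
qed

text \<open>Twice the sum of the bounds for \<open>level_pot\<close> and \<open>next_pot\<close>,
  which covers their values before and after a step.\<close>

definition "pot_bound = 4 * reward + 16 * (real N)\<^sup>2"

lemma level_pot_bound:
  assumes "climb_ok xs (x, m, d, f, s)"
  shows "\<bar>level_pot (x, m, d, f, s)\<bar> \<le> reward + 8 * (real N)\<^sup>2"
proof -
  have "\<bar>excursion_pot N (nat (m - x)) d\<bar> \<le> 8 * (real N)\<^sup>2"
    using assms by (intro excursion_pot_bound) auto
  moreover have "0 \<le> 8 * (real N)\<^sup>2" by simp
  ultimately show ?thesis
    unfolding level_pot.simps using reward_nonneg by (smt (verit))
qed

lemma next_pot_bound: "0 \<le> next_pot (x, m, d, f, s)" "next_pot (x, m, d, f, s) \<le> reward"
  using reward_nonneg eps mult_right_mono[of \<epsilon> 1 reward] by auto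

lemma climb_pot_ge:
  "climb_ok xs (x, m, d, f, s) \<Longrightarrow> \<epsilon> * reward * good_pairs m - pot_bound \<le> climb_pot (x, m, d, f, s)"
  using level_pot_bound[of xs x m d f s] next_pot_bound[of x m d f s] reward_nonneg
  by (simp add: pot_bound_def del: level_pot.simps next_pot.simps) linarith

lemma climb_pot_increment:
  assumes ok: "climb_ok xs (x, m, d, f, s)" and y: "y = x + 1 \<or> y = x - 1"
  shows "\<bar>climb_pot (climb_upd (x, m, d, f, s) y) - climb_pot (x, m, d, f, s)\<bar> \<le> \<epsilon> * reward + pot_bound"
proof -
  obtain x' m' d' f' s' where st': "climb_upd (x, m, d, f, s) y = (x', m', d', f', s')"
    by (metis prod_cases5)
  have "climb_ok (xs @ [y]) (x', m', d', f', s')"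
    by (rule climb_ok_upd[OF ok y, unfolded st'])
  note bounds = level_pot_bound[OF this] level_pot_bound[OF ok]
    next_pot_bound[of x' m' d' f' s'] next_pot_bound[of x m d f s]
  have "x \<le> m" using ok by simp
  then have "m' = m \<or> m' = m + 1" using st' y by (auto split: if_splits)
  then have "good_pairs m \<le> good_pairs m' \<and> good_pairs m' \<le> good_pairs m + 1"
    using good_pairs_Suc[of m] ok by auto
  moreover have "0 \<le> \<epsilon> * reward" using reward_nonneg eps by simp
  ultimately have "\<epsilon> * reward * good_pairs m \<le> \<epsilon> * reward * good_pairs m'"
    "\<epsilon> * reward * good_pairs m' \<le> \<epsilon> * reward * (good_pairs m + 1)"
    by (auto intro!: mult_left_mono)
  then show ?thesis
    using bounds unfolding st'
    by (simp add: pot_bound_def distrib_left del: level_pot.simps next_pot.simps)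
qed

lemma climb_pot_drift:
  assumes ok: "climb_ok xs (x, m, d, f, s)" and p: "p = \<omega> x (count_list xs x)"
  shows "p * (climb_pot (climb_upd (x, m, d, f, s) (x + 1)) - climb_pot (x, m, d, f, s))
    + (1 - p) * (climb_pot (climb_upd (x, m, d, f, s) (x - 1)) - climb_pot (x, m, d, f, s)) \<le> 1"
proof -
  have xs: "xs \<noteq> []" "x = last xs" "x \<le> m" "0 \<le> m" "m - x \<le> int d + 1" "1 \<le> d"
    using ok by auto
  have "1 \<le> count_list xs x" using xs(1) unfolding xs(2) by (intro count_list_pos last_in_set)
  then have p01: "1/2 \<le> p" "p \<le> 1" using p omega by auto
  consider "s" | "\<not> s" "x = m" | "\<not> s" "x < m" using xs by linarith
  then show ?thesis
  proof cases
    \<comment> \<open>First visit to \<open>m\<close>: stepping right forfeits both potentials,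
      stepping left starts the excursion and raises \<open>next_pot\<close> to
      \<open>reward\<close>. The probability \<open>1 - p \<ge> \<epsilon>\<close> pays for both
      when \<open>m\<close> is good.\<close>
    case 1
    then have xm: "x = m" and notin: "m \<notin> set (butlast xs)" and d: "d = 1" using ok by auto
    have "count_list xs x = 1"
      using count_list_eq_butlast[of xs x] notin xs xm by (auto simp: count_list_0_iff)
    then have p_le: "p \<le> 1 - \<epsilon>" if "good m" using good[OF that] p xm by auto
    have "excursion_pot N 1 1 = depth_coeff N 1 - 1"
      using N by (simp add: excursion_pot_def)
    then have "reward \<le> (1 - p) * excursion_pot N 1 1" if "good m"
      unfolding reward_def using p_le[OF that] depth_coeff_ge[of 1 N] N by (auto intro!: mult_right_mono)
    moreover have "\<epsilon> * reward \<le> (1 - p) * reward" if "good m"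
      using p_le[OF that] reward_nonneg by (intro mult_right_mono) auto
    moreover have "0 \<le> (1 - p) * reward" using p01 reward_nonneg by simp
    ultimately show ?thesis
      using 1 xm good_pairs_Suc[OF xs(4)] d by (auto simp: algebra_simps)
  next
    \<comment> \<open>Later visit to \<open>m\<close>: both steps leave \<open>climb_pot\<close>
      unchanged. On the right, the old \<open>next_pot\<close> becomes the new
      \<open>level_pot\<close>, and a new good pair cancels the new \<open>next_pot\<close>.\<close>
    case 2
    then show ?thesis
      using good_pairs_Suc[OF xs(4)] by (auto simp: algebra_simps)
  next
    case 3
    define t where "t = nat (m - x)"
    have t: "1 \<le> t" "t \<le> d + 1" "nat (m - (x + 1)) = t - 1" "nat (m - (x - 1)) = t + 1"
      using 3 xs by (auto simp: t_def)
    have "excursion_pot N t d - p * excursion_pot N (t - 1) (max d t)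
        - (1 - p) * excursion_pot N (t + 1) (max d t) \<le> 1" if "f" "good m"
    proof (cases "t \<le> d")
      case True
      show ?thesis
      proof (cases "2 * N \<le> d")
        case False
        \<comment> \<open>A good \<open>m\<close> is at least \<open>2 * N\<close>, so an
          untruncated excursion above its recorded depth stays on nonnegative sites, where
          \<open>half\<close> applies.\<close>
        have "0 \<le> x" using good[OF that(2)] True False 3 by (auto simp: t_def)
        moreover have "3 \<le> count_list xs x"
        proof -
          have "2 \<le> count_list (butlast xs) x"
            using ok that(1) 3 True \<open>0 \<le> x\<close> by (auto simp: t_def)
          then show ?thesis using count_list_eq_butlast[of xs x] xs by auto
        qed
        ultimately have p_half: "p = 1/2" using half p by auto
        show ?thesis
          using excursion_pot_interior[OF t(1), of N d] True unfolding p_half by (simp add: max_absorb1)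
      qed (use True in \<open>simp add: excursion_pot_def max_absorb1\<close>)
    next
      case False
      then have "t = d + 1" using t by simp
      then show ?thesis
        using excursion_pot_fresh[OF xs(6) p01, of N] by (simp add: max_absorb2)
    qed
    then show ?thesis
      using 3 t by (auto simp: t_def[symmetric] algebra_simps)
  qed
qed

end

subsection \<open>Zero speed\<close>

lemma climb_ok_path: "climb_ok (path_from \<omega> [0] U n) (climb_state (path_from \<omega> [0] U n))"
proof (induction n)
  case 0 then show ?case by (simp add: climb_state_def)
next
  case (Suc n)
  let ?xs = "path_from \<omega> [0] U n"
  obtain x m d f s where st: "climb_state ?xs = (x, m, d, f, s)" by (metis prod_cases5)
  with Suc have ok: "climb_ok ?xs (x, m, d, f, s)" by (simp del: climb_ok.simps)
  then have "?xs \<noteq> []" "x = last ?xs" by auto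
  then show ?case
    using climb_ok_upd[OF ok] st by (auto simp: path_step_def simp del: climb_ok.simps climb_upd.simps)
qed

context climb
begin

lemma AE_climb_pot_le:
  "AE U in unif_seq. \<forall>\<^sub>F n in sequentially. climb_pot (climb_state (path_from \<omega> [0] U n)) \<le> 2 * n"
proof -
  let ?I = "\<lambda>xs. climb_ok xs (climb_state xs)" and ?Z = "\<lambda>xs. climb_pot (climb_state xs)"
  have facts: "xs \<noteq> [] \<and> ?I (xs @ [last xs + 1]) \<and> ?I (xs @ [last xs - 1])"
     "\<bar>?Z (xs @ [last xs + 1]) - ?Z xs\<bar> \<le> \<epsilon> * reward + pot_bound \<and>
      \<bar>?Z (xs @ [last xs - 1]) - ?Z xs\<bar> \<le> \<epsilon> * reward + pot_bound"
     "p = \<omega> (last xs) (count_list xs (last xs)) \<Longrightarrow>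
        p * (?Z (xs @ [last xs + 1]) - ?Z xs) + (1 - p) * (?Z (xs @ [last xs - 1]) - ?Z xs) \<le> 1"
    if "?I xs" for xs p
  proof -
    obtain x m d f s where st: "climb_state xs = (x, m, d, f, s)" by (metis prod_cases5)
    with that have ok: "climb_ok xs (x, m, d, f, s)" by (simp del: climb_ok.simps)
    then have xs: "xs \<noteq> []" "x = last xs" by auto
    show "xs \<noteq> [] \<and> ?I (xs @ [last xs + 1]) \<and> ?I (xs @ [last xs - 1])"
      using climb_ok_upd[OF ok] st xs by (simp del: climb_ok.simps climb_upd.simps)
    show "\<bar>?Z (xs @ [last xs + 1]) - ?Z xs\<bar> \<le> \<epsilon> * reward + pot_bound \<and>
      \<bar>?Z (xs @ [last xs - 1]) - ?Z xs\<bar> \<le> \<epsilon> * reward + pot_bound"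
      using climb_pot_increment[OF ok] st xs by (simp del: climb_pot.simps climb_upd.simps)
    show "p * (?Z (xs @ [last xs + 1]) - ?Z xs) + (1 - p) * (?Z (xs @ [last xs - 1]) - ?Z xs) \<le> 1"
      if "p = \<omega> (last xs) (count_list xs (last xs))"
      using climb_pot_drift[OF ok, of p] st xs that by (simp del: climb_pot.simps climb_upd.simps)
  qed
  have "AE U in unif_seq. \<forall>\<^sub>F n in sequentially. ?Z (path_from \<omega> [0] U n) \<le> (1 + 1) * real n"
  proof (rule AE_path_functional_le[where I = ?I and C = "\<epsilon> * reward + pot_bound"])
    show "0 \<le> \<omega> x i \<and> \<omega> x i \<le> 1" if "1 \<le> i" for x i using omega[OF that, of x] by auto
    show "?I [0]" by (simp add: climb_state_def)
  qed (use facts in \<open>blast+\<close>, simp)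
  then show ?thesis by simp
qed

lemma reward_pos: "0 < reward"
  using depth_coeff_ge[of 1 N] N eps by (auto simp: reward_def)

lemma AE_walk_le:
  assumes dens: "\<And>m. 0 \<le> m \<Longrightarrow> c * real_of_int m - K \<le> good_pairs m" and c: "0 < c"
  shows "AE U in unif_seq. \<forall>\<^sub>F n in sequentially.
    real_of_int (cookie_walk \<omega> 0 U n) \<le> 3 / (\<epsilon> * reward * c) * n"
  using AE_climb_pot_le
proof (rule AE_mp, intro AE_I2 impI)
  fix U assume U: "\<forall>\<^sub>F n in sequentially. climb_pot (climb_state (path_from \<omega> [0] U n)) \<le> 2 * n"
  define e where "e = \<epsilon> * reward"
  have e: "0 < e" using eps reward_pos by (simp add: e_def)
  \<comment> \<open>Additive constants are absorbed into one further \<open>n\<close>, which turns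
    the factor 2 into 3.\<close>
  have "\<forall>\<^sub>F n in sequentially. e * K + pot_bound \<le> real n"
    using filterlim_real_sequentially by (simp add: filterlim_at_top)
  with U show "\<forall>\<^sub>F n in sequentially. real_of_int (cookie_walk \<omega> 0 U n) \<le> 3 / (\<epsilon> * reward * c) * n"
  proof eventually_elim
    case (elim n)
    let ?xs = "path_from \<omega> [0] U n"
    obtain x m d f s where st: "climb_state ?xs = (x, m, d, f, s)" by (metis prod_cases5)
    have ok: "climb_ok ?xs (x, m, d, f, s)" using climb_ok_path[of \<omega> U n] st by (simp del: climb_ok.simps)
    have "e * good_pairs m - pot_bound \<le> 2 * n"
      using climb_pot_ge[OF ok] elim(1) st unfolding e_def by (simp del: climb_pot.simps)
    moreover have "e * (c * m - K) \<le> e * good_pairs m"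
      using dens[of m] ok e by (intro mult_left_mono) auto
    moreover have "e * c * last ?xs \<le> e * c * m"
      using ok e c by (intro mult_left_mono) auto
    ultimately have "e * c * last ?xs \<le> 3 * n"
      using elim(2) by (simp add: algebra_simps)
    then show ?case
      using e c by (simp add: cookie_walk_def cookie_path_eq e_def[symmetric] field_simps)
  qed
qed

end

text \<open>Divergence of the harmonic series: this is the logarithmic growth of the expected
  excursion time.\<close>

lemma depth_coeff_1_unbounded: "\<exists>N\<ge>1. B \<le> depth_coeff N 1"
proof -
  have "\<forall>\<^sub>F n in sequentially. B \<le> harm n"
    using harm_at_top by (simp add: filterlim_at_top)
  then obtain n where n: "n \<ge> 1" "B \<le> harm n"
    by (auto simp: eventually_sequentially) (metis le_add1 le_add2)
  have "(\<Sum>j=1..<Suc n. 1 / real j) = harm n"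
    by (simp only: atLeastLessThanSuc_atLeastAtMost harm_def) (simp add: inverse_eq_divide)
  then have "depth_coeff (Suc n) 1 = 2 + 2 * harm n"
    using n(1) by (simp add: depth_coeff_def)
  moreover have "0 \<le> (harm n :: real)" by (rule harm_nonneg)
  ultimately show ?thesis using n(2) by (intro exI[of _ "Suc n"]) auto
qed

lemma AE_walk_ge:
  fixes \<eta> :: real
  assumes omega: "\<And>x i. 1 \<le> i \<Longrightarrow> 1/2 \<le> \<omega> x i \<and> \<omega> x i \<le> 1" and \<eta>: "0 < \<eta>"
  shows "AE U in unif_seq. \<forall>\<^sub>F n in sequentially. - (\<eta> * n) \<le> real_of_int (cookie_walk \<omega> 0 U n)"
proof -
  have "AE U in unif_seq. \<forall>\<^sub>F n in sequentially. - real_of_int (last (path_from \<omega> [0] U n)) \<le> (0 + \<eta>) * n"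
  proof (rule AE_path_functional_le[where I = "\<lambda>xs. xs \<noteq> []" and C = 1])
    show "0 \<le> \<omega> x i \<and> \<omega> x i \<le> 1" if "1 \<le> i" for x i using omega[OF that, of x] by auto
    fix xs p assume xs: "xs \<noteq> []" and p: "p = \<omega> (last xs) (count_list xs (last xs))"
    have "1 \<le> count_list xs (last xs)" using xs by (intro count_list_pos last_in_set)
    then have "1/2 \<le> p" using omega p by simp
    then show "p * (- real_of_int (last (xs @ [last xs + 1])) - - real_of_int (last xs)) +
        (1 - p) * (- real_of_int (last (xs @ [last xs - 1])) - - real_of_int (last xs)) \<le> 0"
      by (simp add: algebra_simps)
  qed (use \<eta> in auto)
  then show ?thesis
    by (rule AE_mp) (auto simp: cookie_walk_def cookie_path_eq elim!: eventually_mono)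
qed

lemma quenched_zero_speed:
  assumes omega: "\<omega> \<in> Omega_plus"
    and half: "\<And>x i. 0 \<le> x \<Longrightarrow> 3 \<le> i \<Longrightarrow> \<omega> x i = 1/2"
    and eps: "0 < \<epsilon>" "\<epsilon> \<le> 1" and c: "0 < c"
    and dens: "\<And>n. c * real n - K \<le>
      (\<Sum>k<n. if \<omega> (int k) 1 \<le> 1 - \<epsilon> \<and> \<omega> (int k + 1) 1 \<le> 1 - \<epsilon> then 1 else 0)"
  shows "AE U in unif_seq. (\<lambda>n. real_of_int (cookie_walk \<omega> 0 U n) / real n) \<longlonglongrightarrow> 0"
proof -
  have om: "1/2 \<le> \<omega> x i \<and> \<omega> x i \<le> 1" if "1 \<le> i" for x i
    using omega that by (auto simp: Omega_plus_def)
  have upper: "AE U in unif_seq. \<forall>\<^sub>F n in sequentially. real_of_int (cookie_walk \<omega> 0 U n) \<le> \<eta> * n"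
    if \<eta>: "0 < \<eta>" for \<eta> :: real
  proof -
    \<comment> \<open>Since \<open>reward = \<epsilon> * (depth_coeff N 1 - 1)\<close>, this makes
      the speed bound at most \<open>\<eta>\<close>; the summand 1 compensates the subtracted
      1.\<close>
    obtain N where N_large: "1 \<le> N" "3 / (\<epsilon> * \<epsilon> * c * \<eta>) + 1 \<le> depth_coeff N 1"
      using depth_coeff_1_unbounded by blast
    define good where "good k \<longleftrightarrow> 2 * int N \<le> k \<and> \<omega> k 1 \<le> 1 - \<epsilon>" for k
    interpret climb \<omega> N \<epsilon> good
      using N_large(1) eps om half by unfold_locales (auto simp: good_def)
    \<comment> \<open>Discarding the sites below \<open>2 * N\<close> loses at most
      \<open>2 * N\<close> pairs, hence the same positive density \<open>c\<close>.\<close>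
    have good_dens: "c * real_of_int m - (K + 2 * real N) \<le> good_pairs m" if "0 \<le> m" for m
    proof -
      let ?a = "\<lambda>k. if \<omega> (int k) 1 \<le> 1 - \<epsilon> \<and> \<omega> (int k + 1) 1 \<le> 1 - \<epsilon> then 1 else 0 :: real"
      let ?g = "\<lambda>k. if good k \<and> good (k + 1) then 1 else 0 :: real"
      have "c * real (nat m) - K \<le> (\<Sum>k<nat m. ?a k)" by (rule dens)
      also have "\<dots> \<le> (\<Sum>k<nat m. ?g (int k) + (if k < 2 * N then 1 else 0))"
        by (intro sum_mono) (auto simp: good_def)
      also have "\<dots> = (\<Sum>k<nat m. ?g (int k)) + card {k. k < nat m \<and> k < 2 * N}"
        by (simp add: sum.distrib sum.If_cases Int_def)
      also have "card {k. k < nat m \<and> k < 2 * N} \<le> 2 * N"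
        using card_mono[of "{..<2 * N}" "{k. k < nat m \<and> k < 2 * N}"] by auto
      also have "(\<Sum>k<nat m. ?g (int k)) = (\<Sum>k\<in>int ` {..<nat m}. ?g k)"
        by (simp add: sum.reindex)
      also have "\<dots> \<le> good_pairs m"
        unfolding good_pairs_def by (intro sum_mono2) auto
      finally show ?thesis using that by simp
    qed
    have le_eta: "3 / (\<epsilon> * reward * c) \<le> \<eta>"
    proof -
      have "3 / (\<epsilon> * \<epsilon> * c * \<eta>) \<le> depth_coeff N 1 - 1" using N_large(2) by simp
      then show ?thesis
        using reward_pos eps c \<eta> by (simp add: reward_def field_simps)
    qed
    have "AE U in unif_seq. \<forall>\<^sub>F n in sequentially.
        real_of_int (cookie_walk \<omega> 0 U n) \<le> 3 / (\<epsilon> * reward * c) * n"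
      by (rule AE_walk_le[OF good_dens c])
    then show ?thesis
    proof eventually_elim
      case (elim U)
      then show ?case
        by eventually_elim (meson le_eta mult_right_mono of_nat_0_le_iff order_trans)
    qed
  qed
  have "AE U in unif_seq. \<forall>j. \<forall>\<^sub>F n in sequentially.
      \<bar>real_of_int (cookie_walk \<omega> 0 U n)\<bar> \<le> 1 / real (Suc j) * n"
  proof (subst AE_all_countable, intro allI)
    fix j
    have "0 < 1 / real (Suc j)" by simp
    then have "AE U in unif_seq. \<forall>\<^sub>F n in sequentially.
        - (1 / real (Suc j) * n) \<le> real_of_int (cookie_walk \<omega> 0 U n)"
      by (intro AE_walk_ge om)
    with upper[OF \<open>0 < 1 / real (Suc j)\<close>]
    show "AE U in unif_seq. \<forall>\<^sub>F n in sequentially.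
      \<bar>real_of_int (cookie_walk \<omega> 0 U n)\<bar> \<le> 1 / real (Suc j) * n"
    proof eventually_elim
      case (elim U)
      then show ?case by eventually_elim linarith
    qed
  qed
  then show ?thesis
  proof (rule AE_mp, intro AE_I2 impI)
    fix U assume U: "\<forall>j. \<forall>\<^sub>F n in sequentially. \<bar>real_of_int (cookie_walk \<omega> 0 U n)\<bar> \<le> 1 / real (Suc j) * n"
    show "(\<lambda>n. real_of_int (cookie_walk \<omega> 0 U n) / real n) \<longlonglongrightarrow> 0"
    proof (rule tendstoI)
      fix e :: real assume "0 < e"
      then obtain j where j: "1 / real (Suc j) < e"
        using nat_approx_posE by blast
      from U have "\<forall>\<^sub>F n in sequentially. \<bar>real_of_int (cookie_walk \<omega> 0 U n)\<bar> \<le> 1 / real (Suc j) * n"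
        by blast
      with eventually_gt_at_top[of 0]
      show "\<forall>\<^sub>F n in sequentially. dist (real_of_int (cookie_walk \<omega> 0 U n) / real n) 0 < e"
      proof eventually_elim
        case (elim n)
        then have "\<bar>real_of_int (cookie_walk \<omega> 0 U n)\<bar> / n \<le> 1 / real (Suc j)"
          by (simp add: divide_le_eq)
        then show ?case using j by simp
      qed
    qed
  qed
qed

section \<open>Transfer of the hypotheses to almost every environment\<close>

lemma nonneg_part_measurable:
  assumes "sets P = sets env_space"
  shows "nonneg_part \<in> measurable P seq_space"
proof -
  have "nonneg_part \<in> measurable env_space seq_space"
    unfolding nonneg_part_def env_space_def seq_space_def
    by (rule measurable_PiM_single') (auto simp: space_PiM)
  then show ?thesis using measurable_cong_sets[OF assms refl] by blast
qed

lemma seq_shift_measurable: "seq_shift \<in> measurable seq_space seq_space"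
  unfolding seq_shift_def seq_space_def
  by (rule measurable_PiM_single') (auto simp: space_PiM)

lemma seq_shift_funpow: "(seq_shift ^^ k) s = (\<lambda>n. s (n + k))"
  by (induction k) (auto simp: seq_shift_def)

lemma coord_measurable [measurable]: "(\<lambda>s. s k i) \<in> borel_measurable seq_space"
proof -
  have "(\<lambda>s. s k) \<in> measurable seq_space (PiM UNIV (\<lambda>_::nat. (borel :: real measure)))"
    unfolding seq_space_def by measurable
  then show ?thesis by (rule measurable_compose) measurable
qed

text \<open>Stationarity carries the property from site 0 to each further site, and countably many
  null sets are discarded.\<close>

lemma stationary_AE_all:
  assumes P: "prob_space P" "sets P = sets env_space" "nonneg_stationary P"
    and "AE \<omega> in P. \<forall>i\<ge>3. \<omega> 0 i = 1/2"
  shows "AE \<omega> in P. \<forall>x\<ge>0. \<forall>i\<ge>3. \<omega> x i = 1/2"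
proof -
  note [measurable] = nonneg_part_measurable[OF P(2)]
  have sets_Q [measurable_cong]: "sets (nonneg_law P) = sets seq_space"
    by (simp add: nonneg_law_def)
  have "AE s in nonneg_law P. \<forall>i\<ge>3. s k i = 1/2" for k
  proof (induction k)
    case 0
    show ?case unfolding nonneg_law_def
      using assms(4) by (subst AE_distr_iff) (auto simp: nonneg_part_def)
  next
    case (Suc k)
    have "AE s in distr (nonneg_law P) seq_space seq_shift. \<forall>i\<ge>3. s k i = 1/2"
      using Suc P(3)[unfolded nonneg_stationary_def] by (simp only:)
    moreover have "seq_shift \<in> measurable (nonneg_law P) seq_space"
      using seq_shift_measurable by measurable
    ultimately have "AE s in nonneg_law P. \<forall>i\<ge>3. seq_shift s k i = 1/2"
      by (rule AE_distrD[rotated])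
    then show ?case by (simp add: seq_shift_def)
  qed
  then have "AE s in nonneg_law P. \<forall>k. \<forall>i\<ge>3. s k i = 1/2"
    by (simp add: AE_all_countable)
  then have "AE \<omega> in P. \<forall>k. \<forall>i\<ge>3. nonneg_part \<omega> k i = 1/2"
    unfolding nonneg_law_def by (rule AE_distrD[rotated]) measurable
  then show ?thesis
    by (rule AE_mp) (auto simp: nonneg_part_def elim: nonneg_int_cases)
qed

theorem mainTheorem19:
  fixes P :: "env measure"
  assumes "prob_space P"
    and "sets P = sets env_space"
    and "AE \<omega> in P. \<omega> \<in> Omega_plus"
    and "nonneg_stationary P"
    and "nonneg_ergodic P"
    and "AE \<omega> in P. \<forall>i\<ge>3. \<omega> 0 i = 1/2"
    and "measure P {\<omega> \<in> space P. \<omega> 0 1 < 1 \<and> \<omega> 1 1 < 1} > 0"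
  shows "AE \<omega> in P. AE U in unif_seq.
           (\<lambda>n. real_of_int (cookie_walk \<omega> 0 U n) / real n) \<longlonglongrightarrow> 0"
proof -
  interpret P: prob_space P by fact
  note meas [measurable] = nonneg_part_measurable[OF assms(2)]
  define Q where "Q = nonneg_law P"
  interpret Q: prob_space Q
    unfolding Q_def nonneg_law_def by (rule P.prob_space_distr) measurable
  have sets_Q [measurable_cong]: "sets Q = sets seq_space" by (simp add: Q_def nonneg_law_def)
  have space_Q: "space Q = UNIV"
    using sets_eq_imp_space_eq[OF sets_Q] by (simp add: seq_space_def space_PiM)
  \<comment> \<open>These events exhaust the event that both first cookies are below 1, so one of
    them has positive probability and provides \<open>\<epsilon>\<close>.\<close>
  define A where "A j = {s \<in> space Q. s 0 1 \<le> 1 - 1 / real (Suc j) \<and> s 1 1 \<le> 1 - 1 / real (Suc j)}" for j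
  have A_meas [measurable]: "A j \<in> sets Q" for j unfolding A_def by measurable
  have vim: "nonneg_part -` A j \<inter> space P =
      {\<omega> \<in> space P. \<omega> 0 1 \<le> 1 - 1 / real (Suc j) \<and> \<omega> 1 1 \<le> 1 - 1 / real (Suc j)}" for j
    by (auto simp: A_def space_Q nonneg_part_def)
  have "\<exists>j. Q.prob (A j) > 0"
  proof (rule ccontr)
    assume "\<not> ?thesis"
    then have "Q.prob (A j) = 0" for j
      using measure_nonneg[of Q "A j"] by (auto simp: order.order_iff_strict)
    then have "A j \<in> null_sets Q" for j
      by (simp add: null_sets_def Q.emeasure_eq_measure)
    then have "(\<Union>j. A j) \<in> null_sets Q" by auto
    then have "AE s in Q. s \<notin> (\<Union>j. A j)" by (rule AE_not_in)
    then have null: "AE \<omega> in P. nonneg_part \<omega> \<notin> (\<Union>j. A j)"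
      unfolding Q_def nonneg_law_def by (rule AE_distrD[rotated]) measurable
    have mem: "nonneg_part \<omega> \<in> (\<Union>j. A j)" if "\<omega> 0 1 < 1" "\<omega> 1 1 < 1" for \<omega>
    proof -
      have "0 < min (1 - \<omega> 0 1) (1 - \<omega> 1 1)" using that by simp
      then obtain j where "1 / real (Suc j) < min (1 - \<omega> 0 1) (1 - \<omega> 1 1)"
        by (rule nat_approx_posE)
      then show ?thesis by (auto simp: A_def space_Q nonneg_part_def intro!: exI[of _ j])
    qed
    from null have "AE \<omega> in P. \<omega> \<notin> {\<omega> \<in> space P. \<omega> 0 1 < 1 \<and> \<omega> 1 1 < 1}"
      by eventually_elim (use mem in blast)
    \<comment> \<open>\<open>measure\<close> is 0 on nonmeasurable sets, so positivity gives
      measurability.\<close>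
    moreover have "{\<omega> \<in> space P. \<omega> 0 1 < 1 \<and> \<omega> 1 1 < 1} \<in> sets P"
      using assms(7) measure_notin_sets by fastforce
    ultimately have "P.prob {\<omega> \<in> space P. \<omega> 0 1 < 1 \<and> \<omega> 1 1 < 1} = 0"
      by (simp only: P.prob_eq_0)
    then show False using assms(7) by simp
  qed
  then obtain j where j: "Q.prob (A j) > 0" by blast
  define \<epsilon> where "\<epsilon> = 1 / real (Suc j)"
  have eps: "0 < \<epsilon>" "\<epsilon> \<le> 1" by (auto simp: \<epsilon>_def)
  have "AE s in Q. \<exists>c>0. \<exists>K. \<forall>n. c * real n - K \<le> (\<Sum>k<n. indicator (A j) ((seq_shift ^^ k) s))"
  proof (rule Q.ergodic_positive_density)
    show "seq_shift \<in> measurable Q Q" using seq_shift_measurable by measurable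
    have "distr Q Q seq_shift = distr Q seq_space seq_shift" by (rule distr_cong) (auto simp: sets_Q)
    then show "distr Q Q seq_shift = Q" using assms(4) by (simp add: Q_def nonneg_stationary_def)
    show "Q.prob B = 0 \<or> Q.prob B = 1" if "B \<in> sets Q" "seq_shift -` B \<inter> space Q = B" for B
      using that assms(5) sets_Q sets_eq_imp_space_eq[OF sets_Q]
      by (simp add: nonneg_ergodic_def Q_def)
  qed (use j in auto)
  then have dens: "AE \<omega> in P. \<exists>c>0. \<exists>K. \<forall>n. c * real n - K \<le>
      (\<Sum>k<n. indicator (A j) ((seq_shift ^^ k) (nonneg_part \<omega>)))"
    unfolding Q_def nonneg_law_def by (rule AE_distrD[rotated]) measurable
  have ind: "indicator (A j) ((seq_shift ^^ k) (nonneg_part \<omega>)) =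
      (if \<omega> (int k) 1 \<le> 1 - \<epsilon> \<and> \<omega> (int k + 1) 1 \<le> 1 - \<epsilon> then 1 else 0 :: real)" for k \<omega>
    by (auto simp: A_def space_Q seq_shift_funpow nonneg_part_def \<epsilon>_def indicator_def add.commute)
  show ?thesis
    using assms(3) stationary_AE_all[OF assms(1,2,4,6)] dens
  proof eventually_elim
    case (elim \<omega>)
    then obtain c K where "0 < c" "\<forall>n. c * real n - K \<le>
      (\<Sum>k<n. if \<omega> (int k) 1 \<le> 1 - \<epsilon> \<and> \<omega> (int k + 1) 1 \<le> 1 - \<epsilon> then 1 else 0)"
      unfolding ind by blast
    then show ?case
      using elim(1,2) eps by (intro quenched_zero_speed[where \<epsilon> = \<epsilon> and c = c and K = K]) auto
  qed
qed

end
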